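(* Let $n \ge 1$ and $1 \le \ell \le n$ be integers, and let $G_{\mathrm{DPLR}}$ and $G_{\mathrm{Diag}}$ be the transfer functions (defined in the context) of the size-$n$ systems $\Sigma_{\mathrm{DPLR}}$ and $\Sigma_{\mathrm{Diag}}$ with $\mathbf{C}_{\mathrm{DPLR}} = \mathbf{C}_{\mathrm{Diag}} = \mathbf{e}_\ell^\top \mathbf{V}_H$ and $\mathbf{D}_{\mathrm{DPLR}} = \mathbf{D}_{\mathrm{Diag}}$. Then for every $s \in \mathbb{C}$ with $\mathrm{Re}(s) = 0$, $$ G_{\mathrm{Diag}}(s) - G_{\mathrm{DPLR}}(s) = \frac{-s\,\dfrac{(-1)^{n-1} \prod_{j=1}^{n-1} (j-s)}{\prod_{j=1}^n (j+s)}\, \sqrt{2\ell-1}\, \dfrac{\prod_{j=0}^{\ell-2}(s-j)}{\prod_{j=1}^\ell (s+j)}}{\sqrt{2} \left(1 + s\,\dfrac{(-1)^{n-1} \prod_{j=1}^{n-1}(j-s)}{\prod_{j=1}^n (j+s)}\right)}, $$ where empty products equal $1$.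
   Context: Define the real $n \times n$ matrix $\mathbf{A}_H$ and the column vector $\mathbf{B}_H \in \mathbb{R}^n$ (HiPPO-LegS) by $(A_H)_{jk} = -\sqrt{2j-1}\sqrt{2k-1}$ if $j>k$, $(A_H)_{jj} = -j$, $(A_H)_{jk}=0$ if $j<k$; and $(B_H)_j = \sqrt{(2j-1)/2}$. Define $\mathbf{A}_H^\perp = \mathbf{A}_H + \mathbf{B}_H\mathbf{B}_H^\top$; explicitly, $(A_H^\perp)_{jk} = -\tfrac12\sqrt{2j-1}\sqrt{2k-1}$ if $j>k$, $(A_H^\perp)_{jj} = -\tfrac12$, $(A_H^\perp)_{jk} = \tfrac12\sqrt{2j-1}\sqrt{2k-1}$ if $j<k$. This matrix is normal; write $\mathbf{A}_H^\perp = \mathbf{V}_H \boldsymbol{\Lambda}_H \mathbf{V}_H^{-1}$ with $\mathbf{V}_H$ unitary and $\boldsymbol{\Lambda}_H$ diagonal. The DPLR system is $\mathbf{A}_{\mathrm{DPLR}} = \boldsymbol{\Lambda}_H - \mathbf{V}_H^{-1}\mathbf{B}_H\mathbf{B}_H^\top\mathbf{V}_H$ $(= \mathbf{V}_H^{-1}\mathbf{A}_H\mathbf{V}_H)$, $\mathbf{B}_{\mathrm{DPLR}} = \mathbf{V}_H^{-1}\mathbf{B}_H$. The diagonal system is $\mathbf{A}_{\mathrm{Diag}} = \boldsymbol{\Lambda}_H$, $\mathbf{B}_{\mathrm{Diag}} = \tfrac12 \mathbf{V}_H^{-1}\mathbf{B}_H$. Both have output matrix $\mathbf{C}_{\mathrm{DPLR}}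 = \mathbf{C}_{\mathrm{Diag}} = \mathbf{e}_\ell^\top \mathbf{V}_H$, where $\mathbf{e}_\ell$ is the $\ell$th standard basis vector, and a common scalar $\mathbf{D}_{\mathrm{DPLR}} = \mathbf{D}_{\mathrm{Diag}} \in \mathbb{C}$. For $\bullet \in \{\mathrm{DPLR}, \mathrm{Diag}\}$ the transfer function is $G_\bullet(s) = \mathbf{C}_\bullet (s\mathbf{I} - \mathbf{A}_\bullet)^{-1}\mathbf{B}_\bullet + \mathbf{D}_\bullet$. *)

theory Defs
  imports
    Complex_Main
    "Jordan_Normal_Form.Gauss_Jordan_Elimination"
    "Jordan_Normal_Form.Schur_Decomposition"
begin

text \<open>Matrix entries are indexed from \<open>0\<close>, so the entry of a matrix or vector at the
  one-based position \<open>(j, k)\<close> is found at \<open>(j - 1, k - 1)\<close>. Column vectors are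
  \<open>n \<times> 1\<close> matrices and row vectors are \<open>1 \<times> n\<close> matrices.\<close>

definition hippo_A :: "nat \<Rightarrow> real mat" where
  "hippo_A n = mat n n (\<lambda>(i, i').
     let j = i + 1; k = i' + 1 in
       if j > k then - sqrt (2 * real j - 1) * sqrt (2 * real k - 1)
       else if j = k then - real j
       else 0)"

definition hippo_B :: "nat \<Rightarrow> real mat" where
  "hippo_B n = mat n 1 (\<lambda>(i, _). let j = i + 1 in sqrt ((2 * real j - 1) / 2))"

definition hippo_A_perp :: "nat \<Rightarrow> real mat" where
  "hippo_A_perp n = hippo_A n + hippo_B n * transpose_mat (hippo_B n)"

lemma hippo_A_perp_explicit:
  "hippo_A_perp n = mat n n (\<lambda>(i, i').
     let j = i + 1; k = i' + 1 in
       if j > k then - (1/2) * sqrt (2 * real j - 1) * sqrt (2 * real k - 1)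
       else if j = k then - (1/2)
       else (1/2) * sqrt (2 * real j - 1) * sqrt (2 * real k - 1))"
  by (rule eq_matI)
    (auto simp: hippo_A_perp_def hippo_A_def hippo_B_def scalar_prod_def Let_def
      real_sqrt_divide field_simps)

abbreviation cmat :: "real mat \<Rightarrow> complex mat" where
  "cmat \<equiv> map_mat complex_of_real"

definition unitary_mat :: "complex mat \<Rightarrow> bool" where
  "unitary_mat V \<longleftrightarrow> square_mat V \<and> mat_adjoint V * V = 1\<^sub>m (dim_row V)"

text \<open>The value is unspecified if the matrix is not invertible.\<close>

definition mat_inv :: "'a::field mat \<Rightarrow> 'a mat" where
  "mat_inv M = the (mat_inverse M)"

lemma mat_inv_eqI:
  assumes M: "M \<in> carrier_mat n n" and N: "N \<in> carrier_mat n n" and MN: "M * N = 1\<^sub>m n"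
  shows "mat_inv M = N"
proof -
  have NM: "N * M = 1\<^sub>m n"
    using mat_mult_left_right_inverse[OF M N MN] .
  have "M \<in> Units (ring_mat TYPE('a) n ())"
    unfolding Units_def ring_mat_def using M N MN NM by auto
  then obtain K where K: "mat_inverse M = Some K"
    using mat_inverse(1)[OF M, where b = "()"] by (cases "mat_inverse M") auto
  have KM: "K * M = 1\<^sub>m n" and Kc: "K \<in> carrier_mat n n"
    using mat_inverse(2)[OF M K] by auto
  have "K = K * (M * N)"
    using Kc MN by simp
  also have "\<dots> = N"
    using assoc_mult_mat[OF Kc M N] KM N by simp
  finally show ?thesis
    by (simp add: mat_inv_def K)
qed

text \<open>\<open>V\<close> and \<open>\<Lambda>\<close> form a unitary diagonalization of \<open>hippo_A_perp n\<close>.\<close>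

definition hippo_diagonalization :: "nat \<Rightarrow> complex mat \<Rightarrow> complex mat \<Rightarrow> bool" where
  "hippo_diagonalization n V \<Lambda> \<longleftrightarrow>
     V \<in> carrier_mat n n \<and> unitary_mat V \<and>
     \<Lambda> \<in> carrier_mat n n \<and> diagonal_mat \<Lambda> \<and>
     cmat (hippo_A_perp n) = V * \<Lambda> * mat_inv V"

definition A_DPLR :: "nat \<Rightarrow> complex mat \<Rightarrow> complex mat \<Rightarrow> complex mat" where
  "A_DPLR n V \<Lambda> =
     \<Lambda> - mat_inv V * cmat (hippo_B n) * transpose_mat (cmat (hippo_B n)) * V"

definition B_DPLR :: "nat \<Rightarrow> complex mat \<Rightarrow> complex mat" where
  "B_DPLR n V = mat_inv V * cmat (hippo_B n)"

definition A_Diag :: "complex mat \<Rightarrow> complex mat" where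
  "A_Diag \<Lambda> = \<Lambda>"

definition B_Diag :: "nat \<Rightarrow> complex mat \<Rightarrow> complex mat" where
  "B_Diag n V = (1/2) \<cdot>\<^sub>m (mat_inv V * cmat (hippo_B n))"

text \<open>The output matrix of both systems; \<open>l\<close> is one-based.\<close>

definition C_out :: "nat \<Rightarrow> nat \<Rightarrow> complex mat \<Rightarrow> complex mat" where
  "C_out n l V = mat_of_row (unit_vec n (l - 1)) * V"

definition transfer_fun ::
  "complex mat \<Rightarrow> complex mat \<Rightarrow> complex mat \<Rightarrow> complex \<Rightarrow> complex \<Rightarrow> complex" where
  "transfer_fun A B C D s =
     (C * mat_inv (s \<cdot>\<^sub>m 1\<^sub>m (dim_row A) - A) * B) $$ (0, 0) + D"

definition G_DPLR ::
  "nat \<Rightarrow> nat \<Rightarrow> complex mat \<Rightarrow> complex mat \<Rightarrow> complex \<Rightarrow> complex \<Rightarrow> complex" where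
  "G_DPLR n l V \<Lambda> D = transfer_fun (A_DPLR n V \<Lambda>) (B_DPLR n V) (C_out n l V) D"

definition G_Diag ::
  "nat \<Rightarrow> nat \<Rightarrow> complex mat \<Rightarrow> complex mat \<Rightarrow> complex \<Rightarrow> complex \<Rightarrow> complex" where
  "G_Diag n l V \<Lambda> D = transfer_fun (A_Diag \<Lambda>) (B_Diag n V) (C_out n l V) D"

end

theory Submission
  imports Defs
begin

text \<open>Write \<open>A\<close>, \<open>A\<^sup>\<bottom>\<close> and \<open>B\<close> for \<open>hippo_A n\<close>, \<open>hippo_A_perp n\<close> and \<open>hippo_B n\<close>. Conjugating by
  \<open>V\<close> does not change transfer functions, so it suffices to solve
  \<open>(s - A) x = B\<close> and \<open>(s - A\<^sup>\<bottom>) x' = B / 2\<close>. The first system is lower triangular. Put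
  \<open>p\<^sub>i = (\<Prod>j<i. s - j) / (\<Prod>j=1..i. s + j)\<close>; then \<open>x\<^sub>i = sqrt (i + 1/2) p\<^sub>i / (s + i + 1)\<close>
  (counting from \<open>0\<close>), because the sums \<open>\<Sum>k<i. (2k + 1) p\<^sub>k / (s + k + 1)\<close> telescope to
  \<open>1 - p\<^sub>i\<close>. The same telescoping gives \<open>B\<^sup>T x = (1 - p\<^sub>n) / 2\<close>. As \<open>A\<^sup>\<bottom> = A + B B\<^sup>T\<close>, we get
  \<open>(s - A\<^sup>\<bottom>) x = (1 - B\<^sup>T x) B = (1 + p\<^sub>n) B / 2\<close>, so \<open>x' = x / (1 + p\<^sub>n)\<close>, and the difference
  of the transfer functions is \<open>- p\<^sub>n x\<^sub>l\<^sub>-\<^sub>1 / (1 + p\<^sub>n)\<close>. On the imaginary axis \<open>\<bar>p\<^sub>n\<bar> < 1\<close>.\<close>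

section \<open>Linear algebra over a field: rank-one updates and similarity\<close>

lemma right_inverse_mat_unique_solution:
  fixes M :: "'a::field mat"
  assumes M: "M \<in> carrier_mat n n" and R: "R \<in> carrier_mat n n" and MR: "M * R = 1\<^sub>m n"
    and X: "X \<in> carrier_mat n m" and MX: "M * X = Y"
  shows "R * Y = X"
proof -
  have "R * Y = (R * M) * X"
    unfolding MX[symmetric] by (rule assoc_mult_mat[OF R M X, symmetric])
  also have "R * M = 1\<^sub>m n"
    by (rule mat_mult_left_right_inverse[OF M R MR])
  finally show ?thesis
    using X by simp
qed

text \<open>Here \<open>x\<close> stands for the inverse of \<open>M\<close> applied to
  \<open>b\<close>. With \<open>z = c * R\<close>, the product expands to the identity plus
  multiples of \<open>b * z\<close>, whose coefficients cancel. It serves to show that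
  \<open>s\<close> minus the normal matrix is invertible.\<close>

lemma Sherman_Morrison_right_inverse:
  fixes M :: "'a::field mat"
  assumes M: "M \<in> carrier_mat n n" and R: "R \<in> carrier_mat n n" and MR: "M * R = 1\<^sub>m n"
    and b: "b \<in> carrier_mat n 1" and c: "c \<in> carrier_mat 1 n" and x: "x \<in> carrier_mat n 1"
    and Mx: "M * x = b" and cx: "c * x = \<beta> \<cdot>\<^sub>m 1\<^sub>m 1" and \<beta>: "\<beta> \<noteq> 1"
  shows "(M - b * c) * (R + (1 / (1 - \<beta>)) \<cdot>\<^sub>m (x * (c * R))) = 1\<^sub>m n"
proof -
  define k where "k = 1 / (1 - \<beta>)"
  define z where "z = c * R"
  have z: "z \<in> carrier_mat 1 n"
    using c R by (simp add: z_def)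
  have bc: "b * c \<in> carrier_mat n n" and xz: "x * z \<in> carrier_mat n n"
    and bz: "b * z \<in> carrier_mat n n"
    using b c x z by auto
  have "b * c * (x * z) = b * (c * (x * z))"
    using b c xz by (rule assoc_mult_mat)
  also have "c * (x * z) = c * x * z"
    using c x z by (rule assoc_mult_mat[symmetric])
  also have "\<dots> = \<beta> \<cdot>\<^sub>m z"
    unfolding cx using z by (simp add: mult_smult_assoc_mat[of _ 1 1 _ n])
  also have "b * \<dots> = \<beta> \<cdot>\<^sub>m (b * z)"
    using b z by (rule mult_smult_distrib)
  finally have bcxz: "b * c * (x * z) = \<beta> \<cdot>\<^sub>m (b * z)" .
  have Mxz: "M * (x * z) = b * z"
    using assoc_mult_mat[OF M x z] Mx by simp
  have bcR: "b * c * R = b * z"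
    unfolding z_def using b c R by (rule assoc_mult_mat)
  have "(M - b * c) * (R + k \<cdot>\<^sub>m (x * z))
      = (M * R + k \<cdot>\<^sub>m (M * (x * z))) - (b * c * R + k \<cdot>\<^sub>m (b * c * (x * z)))"
    using M bc R xz
    by (simp add: mult_add_distrib_mat[of _ n n _ n] mult_smult_distrib[of _ n n _ n]
        minus_mult_distrib_mat[of _ n n _ _ n])
  also have "\<dots> = (1\<^sub>m n + k \<cdot>\<^sub>m (b * z)) - (b * z + k \<cdot>\<^sub>m (\<beta> \<cdot>\<^sub>m (b * z)))"
    by (simp add: MR bcR Mxz bcxz)
  also have "\<dots> = 1\<^sub>m n"
  proof -
    have "(1\<^sub>m n + k \<cdot>\<^sub>m Y) - (Y + k \<cdot>\<^sub>m (\<beta> \<cdot>\<^sub>m Y)) = 1\<^sub>m n" if Y: "Y \<in> carrier_mat n n" for Y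
    proof -
      \<comment> \<open>This is \<open>1 + k * \<beta> = k\<close>, the equation that fixes the
        choice of \<open>k\<close>.\<close>
      have "w + k * (\<beta> * w) = k * w" for w
        using \<beta> by (simp add: k_def field_simps)
      then show ?thesis
        using Y by (intro eq_matI) simp_all
    qed
    then show ?thesis
      using bz .
  qed
  finally show ?thesis
    by (simp add: k_def z_def)
qed

text \<open>The resolvent of \<open>W * A * V\<close> is \<open>W * R * V\<close>, and the inner
  products \<open>V * W\<close> cancel. Invertibility enters through \<open>R\<close>, while the
  value is computed from a solution \<open>X\<close> for the single right-hand side
  \<open>B\<close>.\<close>

lemma transfer_fun_similar:
  assumes V: "V \<in> carrier_mat n n" and W: "W \<in> carrier_mat n n" and VW: "V * W = 1\<^sub>m n"
    and A: "A \<in> carrier_mat n n" and B: "B \<in> carrier_mat n 1" and C: "C \<in> carrier_mat 1 n"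
    and R: "R \<in> carrier_mat n n" and MR: "(s \<cdot>\<^sub>m 1\<^sub>m n - A) * R = 1\<^sub>m n"
    and X: "X \<in> carrier_mat n 1" and MX: "(s \<cdot>\<^sub>m 1\<^sub>m n - A) * X = B"
  shows "transfer_fun (W * A * V) (W * B) (C * V) D s = (C * X) $$ (0, 0) + D"
proof -
  define M where "M = s \<cdot>\<^sub>m 1\<^sub>m n - A"
  have M: "M \<in> carrier_mat n n"
    unfolding M_def by (rule minus_carrier_mat[OF A])
  have WV: "W * V = 1\<^sub>m n"
    by (rule mat_mult_left_right_inverse[OF V W VW])
  have cancel: "V * (W * Y) = Y" if "Y \<in> carrier_mat n m" for Y m
    using assoc_mult_mat[OF V W that] VW that by simp
  have sM: "s \<cdot>\<^sub>m 1\<^sub>m n - W * A * V = W * M * V"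
  proof -
    have "W * M * V = (W * (s \<cdot>\<^sub>m 1\<^sub>m n) - W * A) * V"
      unfolding M_def using W A by (simp add: mult_minus_distrib_mat[of _ n n _ n])
    also have "\<dots> = W * (s \<cdot>\<^sub>m 1\<^sub>m n) * V - W * A * V"
      using W V A by (intro minus_mult_distrib_mat) auto
    also have "W * (s \<cdot>\<^sub>m 1\<^sub>m n) * V = s \<cdot>\<^sub>m 1\<^sub>m n"
      using W V WV
      by (simp add: mult_smult_distrib[of _ n n _ n] mult_smult_assoc_mat[of _ n n _ n])
    finally show ?thesis by simp
  qed
  have "W * M * V * (W * R * V) = W * (M * (V * (W * (R * V))))"
    using W M V R by (simp add: assoc_mult_mat[of _ n n _ n _ n])
  also have "\<dots> = W * (M * R * V)"
    using M V R by (simp add: cancel[of _ n] assoc_mult_mat[of _ n n _ n _ n])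
  also have "\<dots> = 1\<^sub>m n"
    using MR V WV by (simp add: M_def)
  finally have "mat_inv (W * M * V) = W * R * V"
    using W M V R by (intro mat_inv_eqI[of _ n]) auto
  then have "C * V * mat_inv (W * M * V) * (W * B) = C * (V * (W * (R * (V * (W * B)))))"
    using C W R V B
    by (simp add: assoc_mult_mat[of _ 1 n _ n _ n] assoc_mult_mat[of _ 1 n _ n _ 1]
        assoc_mult_mat[of _ n n _ n _ n] assoc_mult_mat[of _ n n _ n _ 1])
  also have "\<dots> = C * (R * B)"
    using R B by (simp add: cancel[of _ 1])
  also have "R * B = X"
    by (rule right_inverse_mat_unique_solution[OF minus_carrier_mat[OF A] R MR X MX])
  finally show ?thesis
    using W by (simp add: transfer_fun_def sM)
qed

section \<open>The ratios \<open>hippo_ratio s i\<close> and their telescoping sum\<close>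

definition hippo_ratio :: "complex \<Rightarrow> nat \<Rightarrow> complex" where
  "hippo_ratio s i = (\<Prod>j<i. (s - of_nat j)) / (\<Prod>j = 1..i. (s + of_nat j))"

lemma hippo_ratio_0 [simp]: "hippo_ratio s 0 = 1"
  by (simp add: hippo_ratio_def)

lemma hippo_ratio_Suc:
  "hippo_ratio s (Suc i) = hippo_ratio s i * ((s - of_nat i) / (s + of_nat (Suc i)))"
  by (simp add: hippo_ratio_def)

text \<open>The numerator factor for \<open>j = 0\<close> is \<open>s\<close>; reversing the sign of
  the other \<open>n - 1\<close> factors produces the power of \<open>-1\<close>.\<close>

lemma hippo_ratio_eq:
  assumes "n \<ge> 1"
  shows "hippo_ratio s n =
    s * ((-1) ^ (n - 1) * (\<Prod>j = 1..n - 1. (of_nat j - s)) / (\<Prod>j = 1..n. (of_nat j + s)))"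
proof -
  obtain m where n: "n = Suc m"
    using assms by (cases n) auto
  have "(\<Prod>j<Suc m. (s - of_nat j)) = s * ((-1) ^ m * (\<Prod>j = 1..m. (of_nat j - s)))"
    by (induction m) (simp_all add: algebra_simps)
  then show ?thesis
    by (simp add: hippo_ratio_def n add.commute del: prod.lessThan_Suc prod.cl_ivl_Suc)
qed

lemma add_of_nat_Suc_neq_0:
  assumes "Re s \<ge> 0"
  shows "s + of_nat (Suc i) \<noteq> 0"
proof
  assume "s + of_nat (Suc i) = 0"
  then have "Re (s + of_nat (Suc i)) = 0"
    by (simp only: zero_complex.sel)
  then show False
    using assms by simp
qed

text \<open>In each factor, numerator and denominator have the same imaginary part, and their real
  parts are \<open>-i\<close> and \<open>i + 1\<close>, so the quotient has norm below 1. The bound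
  is strict only from \<open>n = 1\<close> on, since the empty product is 1.\<close>

lemma norm_hippo_ratio:
  assumes s: "Re s = 0" and "n \<ge> 1"
  shows "norm (hippo_ratio s n) < 1"
proof -
  have factor: "norm ((s - of_nat i) / (s + of_nat (Suc i))) < 1" for i
  proof -
    have "(norm (s - of_nat i))\<^sup>2 < (norm (s + of_nat (Suc i)))\<^sup>2"
      unfolding cmod_power2 using s by (simp add: power2_eq_square algebra_simps)
    then have "norm (s - of_nat i) < norm (s + of_nat (Suc i))"
      by (rule power2_less_imp_less) simp
    moreover have "0 < norm (s + of_nat (Suc i))"
      using add_of_nat_Suc_neq_0[of s i] s by (simp only: zero_less_norm_iff) simp
    ultimately show ?thesis
      by (simp only: norm_divide divide_less_eq_1_pos)
  qed
  have "norm (hippo_ratio s (Suc m)) < 1" for m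
  proof (induction m)
    case 0
    show ?case
      using factor[of 0] by (simp add: hippo_ratio_Suc)
  next
    case (Suc m)
    show ?case
      unfolding hippo_ratio_Suc[of s "Suc m"] norm_mult
      by (rule mult_strict_mono'[OF Suc factor, of "Suc m", simplified mult_1]) simp_all
  qed
  from this[of "n - 1"] show ?thesis
    using \<open>n \<ge> 1\<close> by simp
qed

text \<open>Since \<open>2 * k + 1\<close> is the difference of \<open>s + (k + 1)\<close> and
  \<open>s - k\<close>, each summand equals
  \<open>hippo_ratio s k - hippo_ratio s (Suc k)\<close>.\<close>

lemma sum_hippo_ratio:
  assumes "Re s \<ge> 0"
  shows "(\<Sum>k<i. of_nat (2 * k + 1) * (hippo_ratio s k / (s + of_nat (Suc k)))) = 1 - hippo_ratio s i"
proof (induction i)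
  case (Suc i)
  have *: "s + of_nat (Suc i) \<noteq> 0"
    by (rule add_of_nat_Suc_neq_0[OF assms])
  have "of_nat (2 * i + 1) * (hippo_ratio s i / (s + of_nat (Suc i)))
      = hippo_ratio s i * ((s + of_nat (Suc i) - (s - of_nat i)) / (s + of_nat (Suc i)))"
    by simp
  also have "\<dots> = hippo_ratio s i - hippo_ratio s (Suc i)"
    unfolding hippo_ratio_Suc by (simp only: diff_divide_distrib divide_self[OF *]
        right_diff_distrib mult_1_right)
  finally show ?case
    using Suc by simp
qed simp

section \<open>Solving the triangular HiPPO system\<close>

definition hippo_sol :: "nat \<Rightarrow> complex \<Rightarrow> complex mat" where
  "hippo_sol n s = mat n 1 (\<lambda>(i, _).
     complex_of_real (sqrt ((2 * real i + 1) / 2)) * (hippo_ratio s i / (s + of_nat (Suc i))))"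

lemma hippo_A_carrier: "cmat (hippo_A n) \<in> carrier_mat n n"
  and hippo_B_carrier: "cmat (hippo_B n) \<in> carrier_mat n 1"
  and hippo_sol_carrier: "hippo_sol n s \<in> carrier_mat n 1"
  by (simp_all add: hippo_A_def hippo_B_def hippo_sol_def)

lemma sqrt_mult_sqrt_half:
  "complex_of_real (sqrt (2 * real k + 1)) * complex_of_real (sqrt ((2 * real k + 1) / 2))
    = of_nat (2 * k + 1) / complex_of_real (sqrt 2)"
proof -
  have "sqrt (2 * real k + 1) * sqrt ((2 * real k + 1) / 2) = real (2 * k + 1) / sqrt 2"
    by (simp add: real_sqrt_divide)
  then show ?thesis
    by (metis of_real_divide of_real_mult of_real_of_nat_eq)
qed

text \<open>After \<open>h i\<close> is factored out of row \<open>i\<close>, the strictly lower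
  part contributes \<open>1 - hippo_ratio s i\<close> by telescoping and the diagonal contributes
  \<open>hippo_ratio s i\<close>.\<close>

lemma hippo_sol_eq:
  assumes s: "Re s \<ge> 0"
  shows "(s \<cdot>\<^sub>m 1\<^sub>m n - cmat (hippo_A n)) * hippo_sol n s = cmat (hippo_B n)"
proof (rule eq_matI)
  fix i j
  assume "i < dim_row (cmat (hippo_B n))" and "j < dim_col (cmat (hippo_B n))"
  then have i: "i < n" and j: "j = 0"
    by (simp_all add: hippo_B_def)
  \<comment> \<open>Zero-based forms of the square roots in \<open>hippo_A\<close>
    (\<open>r\<close>) and \<open>hippo_B\<close> (\<open>h\<close>); they differ by the factor
    \<open>sqrt 2\<close>, which lets \<open>h i\<close> be pulled out of the row.\<close>
  define r where "r k = complex_of_real (sqrt (1 + 2 * real k))" for k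
  define h where "h k = complex_of_real (sqrt ((2 * real k + 1) / 2))" for k
  define y where "y k = hippo_ratio s k / (s + of_nat (Suc k))" for k
  define f where "f k = (if k < i then r i * r k else if k = i then s + of_nat (Suc i) else 0)
    * (h k * y k)" for k
  have "((s \<cdot>\<^sub>m 1\<^sub>m n - cmat (hippo_A n)) * hippo_sol n s) $$ (i, j) = (\<Sum>k<n. f k)"
    using i by (auto simp: j hippo_sol_def hippo_A_def scalar_prod_def f_def r_def h_def y_def Let_def
        lessThan_atLeast0 intro!: sum.cong)
  also have "\<dots> = (\<Sum>k<Suc i. f k)"
    using i by (intro sum.mono_neutral_right) (auto simp: f_def)
  also have "\<dots> = (\<Sum>k<i. r i * r k * (h k * y k)) + (s + of_nat (Suc i)) * (h i * y i)"
    by (simp add: f_def)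
  also have "(\<Sum>k<i. r i * r k * (h k * y k))
      = (\<Sum>k<i. h i * (of_nat (2 * k + 1) * y k))"
  proof (rule sum.cong)
    fix k
    have "r k * h k = of_nat (2 * k + 1) / complex_of_real (sqrt 2)"
      unfolding r_def h_def add.commute[of 1] by (rule sqrt_mult_sqrt_half)
    moreover have "h i = r i / complex_of_real (sqrt 2)"
      unfolding h_def r_def add.commute[of 1] by (simp add: real_sqrt_divide)
    moreover have "r i * r k * (h k * y k) = r i * (r k * h k) * y k"
      by (simp only: mult_ac)
    ultimately show "r i * r k * (h k * y k) = h i * (of_nat (2 * k + 1) * y k)"
      by simp
  qed simp
  also have "\<dots> = h i * (1 - hippo_ratio s i)"
    using sum_hippo_ratio[OF s, of i] by (simp only: sum_distrib_left[symmetric] y_def)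
  also have "(s + of_nat (Suc i)) * (h i * y i) = h i * hippo_ratio s i"
    using add_of_nat_Suc_neq_0[OF s, of i] by (simp only: y_def) simp
  also have "h i * (1 - hippo_ratio s i) + h i * hippo_ratio s i = cmat (hippo_B n) $$ (i, j)"
    using i by (simp add: j hippo_B_def h_def Let_def algebra_simps)
  finally show "((s \<cdot>\<^sub>m 1\<^sub>m n - cmat (hippo_A n)) * hippo_sol n s) $$ (i, j)
    = cmat (hippo_B n) $$ (i, j)" .
qed (simp_all add: hippo_A_def hippo_B_def hippo_sol_def)

text \<open>The square of \<open>h k\<close> is \<open>(2 * k + 1) / 2\<close>, so the product is
  half of the telescoping sum up to \<open>n\<close>.\<close>

lemma hippo_B_sol:
  assumes s: "Re s \<ge> 0"
  shows "transpose_mat (cmat (hippo_B n)) * hippo_sol n s = ((1 - hippo_ratio s n) / 2) \<cdot>\<^sub>m 1\<^sub>m 1"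
proof (rule eq_matI)
  fix i j
  assume "i < dim_row (((1 - hippo_ratio s n) / 2) \<cdot>\<^sub>m (1\<^sub>m 1 :: complex mat))"
    and "j < dim_col (((1 - hippo_ratio s n) / 2) \<cdot>\<^sub>m (1\<^sub>m 1 :: complex mat))"
  then have ij: "i = 0" "j = 0"
    by simp_all
  define h where "h k = complex_of_real (sqrt ((2 * real k + 1) / 2))" for k
  define y where "y k = hippo_ratio s k / (s + of_nat (Suc k))" for k
  have "(transpose_mat (cmat (hippo_B n)) * hippo_sol n s) $$ (i, j) = (\<Sum>k<n. h k * (h k * y k))"
    by (auto simp: ij hippo_B_def hippo_sol_def scalar_prod_def h_def y_def lessThan_atLeast0
        Let_def intro!: sum.cong)
  also have "\<dots> = (\<Sum>k<n. 1 / 2 * (of_nat (2 * k + 1) * y k))"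
  proof (rule sum.cong)
    fix k
    have "sqrt ((2 * real k + 1) / 2) * sqrt ((2 * real k + 1) / 2) = real (2 * k + 1) / 2"
      by simp
    then have "h k * h k = of_nat (2 * k + 1) / 2"
      unfolding h_def by (metis of_real_divide of_real_mult of_real_numeral of_real_of_nat_eq)
    then show "h k * (h k * y k) = 1 / 2 * (of_nat (2 * k + 1) * y k)"
      unfolding mult.assoc[symmetric] by (simp only: mult_1 times_divide_eq_left)
  qed simp
  also have "\<dots> = 1 / 2 * (1 - hippo_ratio s n)"
    using sum_hippo_ratio[OF s, of n] by (simp only: sum_distrib_left[symmetric] y_def)
  finally show "(transpose_mat (cmat (hippo_B n)) * hippo_sol n s) $$ (i, j)
      = (((1 - hippo_ratio s n) / 2) \<cdot>\<^sub>m 1\<^sub>m 1) $$ (i, j)"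
    by (simp add: ij)
qed (simp_all add: hippo_B_def hippo_sol_def)

text \<open>A solution for one right-hand side does not give invertibility. That comes from the
  determinant, the product of the nonzero diagonal entries
  \<open>s + of_nat (Suc i)\<close>.\<close>

lemma hippo_A_right_inverse:
  assumes s: "Re s \<ge> 0"
  obtains R where "R \<in> carrier_mat n n" and "(s \<cdot>\<^sub>m 1\<^sub>m n - cmat (hippo_A n)) * R = 1\<^sub>m n"
proof -
  define M where "M = s \<cdot>\<^sub>m 1\<^sub>m n - cmat (hippo_A n)"
  have M: "M \<in> carrier_mat n n"
    unfolding M_def by (rule minus_carrier_mat[OF hippo_A_carrier])
  have "det M = prod_list (diag_mat M)"
    by (rule det_lower_triangular[OF _ M]) (simp add: M_def hippo_A_def)
  also have "\<dots> \<noteq> 0"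
  proof -
    have "M $$ (i, i) = s + of_nat (Suc i)" if "i < n" for i
      using that by (simp add: M_def hippo_A_def)
    then have "M $$ (i, i) \<noteq> 0" if "i < n" for i
      using that add_of_nat_Suc_neq_0[OF s, of i] by (simp only:) simp
    then show ?thesis
      using M by (auto simp: diag_mat_def)
  qed
  finally have "M \<in> Units (ring_mat TYPE(complex) n ())"
    by (rule det_non_zero_imp_unit[OF M])
  then show thesis
    using that by (auto simp: Units_def ring_mat_def M_def)
qed

text \<open>The inverse is the adjoint: \<open>unitary_mat\<close> supplies it on the left, and for
  square matrices a left inverse is also a right inverse.\<close>

lemma unitary_mat_inv:
  assumes V: "V \<in> carrier_mat n n" and "unitary_mat V"
  shows "mat_inv V \<in> carrier_mat n n" and "V * mat_inv V = 1\<^sub>m n"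
proof -
  have W: "mat_adjoint V \<in> carrier_mat n n"
    using V by (intro carrier_matI) (simp_all add: mat_adjoint_def)
  have WV: "mat_adjoint V * V = 1\<^sub>m n"
    using assms by (simp add: unitary_mat_def)
  have VW: "V * mat_adjoint V = 1\<^sub>m n"
    by (rule mat_mult_left_right_inverse[OF W V WV])
  have "mat_inv V = mat_adjoint V"
    by (rule mat_inv_eqI[OF V W VW])
  with W VW show "mat_inv V \<in> carrier_mat n n" and "V * mat_inv V = 1\<^sub>m n"
    by simp_all
qed

section \<open>Comparison of the two transfer functions\<close>

theorem lemma1:
  fixes n l :: nat and V \<Lambda> :: "complex mat" and D s :: complex
  assumes "n \<ge> 1" and "1 \<le> l" and "l \<le> n"
    and "hippo_diagonalization n V \<Lambda>"
    and "Re s = 0"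
  shows "G_Diag n l V \<Lambda> D s - G_DPLR n l V \<Lambda> D s =
    (- s * ((-1) ^ (n - 1) * (\<Prod>j = 1..n - 1. (of_nat j - s)) / (\<Prod>j = 1..n. (of_nat j + s)))
       * complex_of_real (sqrt (2 * real l - 1))
       * ((\<Prod>j \<in> {..<l - 1}. (s - of_nat j)) / (\<Prod>j = 1..l. (s + of_nat j))))
    / (complex_of_real (sqrt 2)
       * (1 + s * ((-1) ^ (n - 1) * (\<Prod>j = 1..n - 1. (of_nat j - s)) / (\<Prod>j = 1..n. (of_nat j + s)))))"
proof -
  note n = \<open>n \<ge> 1\<close>
  have s: "Re s \<ge> 0"
    using \<open>Re s = 0\<close> by simp
  define W where "W = mat_inv V"
  define A where "A = cmat (hippo_A n)"
  define Ap where "Ap = cmat (hippo_A_perp n)"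
  define B where "B = cmat (hippo_B n)"
  define x where "x = hippo_sol n s"
  define p where "p = hippo_ratio s n"
  define M where "M = s \<cdot>\<^sub>m 1\<^sub>m n - A"
  define Mp where "Mp = s \<cdot>\<^sub>m 1\<^sub>m n - Ap"
  define C :: "complex mat" where "C = mat_of_row (unit_vec n (l - 1))"
  have V: "V \<in> carrier_mat n n" and \<Lambda>: "\<Lambda> \<in> carrier_mat n n"
    and W: "W \<in> carrier_mat n n" and VW: "V * W = 1\<^sub>m n" and ApV: "Ap = V * \<Lambda> * W"
    using \<open>hippo_diagonalization n V \<Lambda>\<close> unitary_mat_inv[of V n]
    by (simp_all add: hippo_diagonalization_def W_def Ap_def)
  have A: "A \<in> carrier_mat n n" and B: "B \<in> carrier_mat n 1" and x: "x \<in> carrier_mat n 1"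
    unfolding A_def B_def x_def
    by (rule hippo_A_carrier hippo_B_carrier hippo_sol_carrier)+
  have C: "C \<in> carrier_mat 1 n"
    by (simp add: C_def)
  have BT: "transpose_mat B \<in> carrier_mat 1 n"
    using B by simp
  have BBT: "B * transpose_mat B \<in> carrier_mat n n"
    using B by simp
  have Ap_eq: "Ap = A + B * transpose_mat B"
    by (rule eq_matI)
      (auto simp: Ap_def A_def B_def hippo_A_perp_def hippo_A_def hippo_B_def scalar_prod_def)
  have Ap: "Ap \<in> carrier_mat n n"
    using A BBT by (simp add: Ap_eq)
  have M: "M \<in> carrier_mat n n"
    unfolding M_def by (rule minus_carrier_mat[OF A])
  have Mp_eq: "Mp = M - B * transpose_mat B"
    unfolding Mp_def M_def Ap_eq using A BBT
    by (intro eq_matI) (auto simp del: index_mult_mat(1))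
  have Mp: "Mp \<in> carrier_mat n n"
    unfolding Mp_def by (rule minus_carrier_mat[OF Ap])
  have p1: "1 + p \<noteq> 0"
  proof
    assume "1 + p = 0"
    then have "p = -1"
      by (simp add: eq_neg_iff_add_eq_0 add.commute)
    then show False
      using norm_hippo_ratio[OF \<open>Re s = 0\<close> n] by (simp add: p_def)
  qed
  have Mx: "M * x = B"
    unfolding M_def A_def B_def x_def by (rule hippo_sol_eq[OF s])
  have Bx: "transpose_mat B * x = ((1 - p) / 2) \<cdot>\<^sub>m 1\<^sub>m 1"
    unfolding B_def x_def p_def by (rule hippo_B_sol[OF s])
  obtain R where R: "R \<in> carrier_mat n n" and MR: "M * R = 1\<^sub>m n"
    using hippo_A_right_inverse[OF s] unfolding M_def A_def by blast
  \<comment> \<open>The nondegeneracy condition of the rank-one update, equivalent to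
    \<open>1 + p \<noteq> 0\<close>.\<close>
  have "(1 - p) / 2 \<noteq> 1"
    using p1 by (auto simp: field_simps add_eq_0_iff2)
  note inverse = Sherman_Morrison_right_inverse[OF M R MR B BT x Mx Bx this, folded Mp_eq]
  obtain Rp where Rp: "Rp \<in> carrier_mat n n" and MpRp: "Mp * Rp = 1\<^sub>m n"
  proof
    show "R + (1 / (1 - (1 - p) / 2)) \<cdot>\<^sub>m (x * (transpose_mat B * R)) \<in> carrier_mat n n"
      by (intro add_carrier_mat smult_carrier_mat mult_carrier_mat[OF x] mult_carrier_mat[OF BT R])
  qed (rule inverse)
  have Mpx: "Mp * ((1 / (1 + p)) \<cdot>\<^sub>m x) = (1 / 2) \<cdot>\<^sub>m B"
  proof -
    have "Mp * x = B - B * (transpose_mat B * x)"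
      unfolding Mp_eq using minus_mult_distrib_mat[OF M BBT x] assoc_mult_mat[OF B BT x] Mx
      by simp
    also have "\<dots> = B - ((1 - p) / 2) \<cdot>\<^sub>m B"
      unfolding Bx using B by (simp add: mult_smult_distrib[of _ n 1 _ 1])
    finally have "Mp * ((1 / (1 + p)) \<cdot>\<^sub>m x) = (1 / (1 + p)) \<cdot>\<^sub>m (B - ((1 - p) / 2) \<cdot>\<^sub>m B)"
      using mult_smult_distrib[OF Mp x] by simp
    also have "\<dots> = (1 / 2) \<cdot>\<^sub>m B"
    proof -
      have "w - (1 - p) / 2 * w = (1 + p) * (1 / 2 * w)" for w
        by (simp add: field_simps)
      then have "1 / (1 + p) * (w - (1 - p) / 2 * w) = 1 / 2 * w" for w
        using p1 by simp
      then show ?thesis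
        using B by (intro eq_matI) simp_all
    qed
    finally show ?thesis .
  qed
  have WV: "W * V = 1\<^sub>m n"
    by (rule mat_mult_left_right_inverse[OF V W VW])
  \<comment> \<open>Both state matrices become conjugates by \<open>V\<close>, of \<open>Ap\<close>
    here and of \<open>A\<close> below, where the rank-one term cancels.\<close>
  have \<Lambda>_eq: "\<Lambda> = W * Ap * V"
  proof -
    have "W * Ap * V = (W * V) * \<Lambda> * (W * V)"
      unfolding ApV using V W \<Lambda> by (simp add: assoc_mult_mat[of _ n n _ n _ n])
    then show ?thesis
      using WV \<Lambda> by simp
  qed
  have "A_DPLR n V \<Lambda> = W * Ap * V - W * (B * transpose_mat B) * V"
    using W B BT by (simp add: A_DPLR_def \<Lambda>_eq W_def B_def assoc_mult_mat[of _ n n _ 1 _ n])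
  also have "\<dots> = W * (Ap - B * transpose_mat B) * V"
    using W V Ap BBT
    by (simp add: minus_mult_distrib_mat[of _ n n _ _ n] mult_minus_distrib_mat[of _ n n _ n])
  also have "Ap - B * transpose_mat B = A"
    unfolding Ap_eq using A BBT by (intro eq_matI) (auto simp del: index_mult_mat(1))
  finally have A_DPLR: "A_DPLR n V \<Lambda> = W * A * V" .
  have "G_DPLR n l V \<Lambda> D s = (C * x) $$ (0, 0) + D"
    unfolding G_DPLR_def A_DPLR B_DPLR_def C_out_def W_def[symmetric] B_def[symmetric]
      C_def[symmetric]
    using transfer_fun_similar[OF V W VW A B C R _ x] MR Mx by (simp add: M_def)
  moreover have "G_Diag n l V \<Lambda> D s = (C * ((1 / (1 + p)) \<cdot>\<^sub>m x)) $$ (0, 0) + D"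
  proof -
    have "B_Diag n V = W * ((1 / 2) \<cdot>\<^sub>m B)"
      unfolding B_Diag_def W_def[symmetric] B_def[symmetric]
      using mult_smult_distrib[OF W B] by simp
    then show ?thesis
      unfolding G_Diag_def A_Diag_def C_out_def C_def[symmetric]
      using transfer_fun_similar[OF V W VW Ap smult_carrier_mat[OF B] C Rp _ smult_carrier_mat[OF x]]
        MpRp Mpx by (simp add: Mp_def \<Lambda>_eq)
  qed
  moreover have Cx: "(C * X) $$ (0, 0) = X $$ (l - 1, 0)" if "X \<in> carrier_mat n 1" for X
  proof -
    have "col X 0 \<in> carrier_vec n"
      using that by auto
    then have "unit_vec n (l - 1) \<bullet> col X 0 = col X 0 $ (l - 1)"
      using \<open>1 \<le> l\<close> \<open>l \<le> n\<close> by (intro scalar_prod_left_unit) auto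
    then show ?thesis
      using that \<open>1 \<le> l\<close> \<open>l \<le> n\<close> by (simp add: C_def)
  qed
  ultimately have "G_Diag n l V \<Lambda> D s - G_DPLR n l V \<Lambda> D s
      = 1 / (1 + p) * x $$ (l - 1, 0) - x $$ (l - 1, 0)"
    using x \<open>1 \<le> l\<close> \<open>l \<le> n\<close> by simp
  also have "\<dots> = - p * x $$ (l - 1, 0) / (1 + p)"
    using p1 by (simp add: field_simps)
  \<comment> \<open>At the zero-based index \<open>l - 1\<close>, the extra denominator
    \<open>s + of_nat l\<close> of \<open>hippo_sol\<close> extends the product in
    \<open>hippo_ratio s (l - 1)\<close> up to \<open>j = l\<close>.\<close>
  also have "x $$ (l - 1, 0) = complex_of_real (sqrt (2 * real l - 1)) / complex_of_real (sqrt 2)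
      * ((\<Prod>j \<in> {..<l - 1}. (s - of_nat j)) / (\<Prod>j = 1..l. (s + of_nat j)))"
  proof -
    obtain m where "l = Suc m"
      using \<open>1 \<le> l\<close> by (cases l) auto
    then show ?thesis
      using \<open>l \<le> n\<close> by (simp add: x_def hippo_sol_def hippo_ratio_def real_sqrt_divide)
  qed
  finally show ?thesis
    unfolding p_def hippo_ratio_eq[OF n] by (simp add: mult_ac)
qed

end
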